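(* In the line-square setting described in the context, suppose that $a_1(1)\le -1$ and $1<a_1(2)$. Set $$n:=1+\left\lfloor \frac{-1-a_1(1)}{(u(1)+1)\,v(1)^2}\right\rfloor .$$ Then Dykstra's algorithm stalls, i.e. $b_1=b_2=\cdots=b_n=(-1,1)$; it then "breaks free" with $b_{n+1}\neq(-1,1)$; and it finally acts like MAP with starting point $b_{n+1}$, i.e. for every $k\ge 1$, $a_{n+1+k}=P_A(b_{n+k})$ and $b_{n+1+k}=P_B(a_{n+1+k})$.
   Context: Line-square setting: $X=\mathbb{R}^2$ with the Euclidean inner product $\langle\cdot,\cdot\rangle$ and norm; for $x\in\mathbb{R}^2$ write $x=(x(1),x(2))$, and likewise $x_n=(x_n(1),x_n(2))$ for sequences. $z\in X$ is arbitrary. $B=[-1,1]\times[-1,1]$. $A$ is a line in $\mathbb{R}^2$ of the form $A=u+\{v\}^\perp$, where $u\in A\cap B$ satisfies $u(1)>-1$ and $u(2)=1$, and $v\in (A-A)^\perp$ satisfies $\|v\|=1$, $v(1)>0$, $v(2)>0$. $P_C$ denotes the projection onto a nonempty closed convex set $C$. $\lfloor\cdot\rfloor$ is the floor function. Dykstra's algorithm for $(A,B,z)$: set $b_0=z$, $p_0=0$, $q_0=0$ and for $n\ge 1$ $a_n=P_A(b_{n-1}+p_{n-1})$, $p_n=b_{n-1}+p_{n-1}-a_n$, $b_n=P_B(a_n+q_{n-1})$, $q_n=a_n+q_{n-1}-b_n$. The main sequences are $(a_n)$ and $(b_n)$; the auxiliary sequences are $(p_n)$ and $(q_n)$. The method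 of alternating projections (MAP) with starting point $c_0$ is $c_{2k-1}=P_A(c_{2k-2})$, $c_{2k}=P_B(c_{2k-1})$ for $k\ge 1$. *)

theory Defs
  imports "HOL-Analysis.Analysis"
begin

(* The value a 0 is not part of Dykstra's algorithm and is left unconstrained. *)
definition dykstra ::
    "'a::euclidean_space set \<Rightarrow> 'a set \<Rightarrow> 'a \<Rightarrow>
     (nat \<Rightarrow> 'a) \<Rightarrow> (nat \<Rightarrow> 'a) \<Rightarrow> (nat \<Rightarrow> 'a) \<Rightarrow> (nat \<Rightarrow> 'a) \<Rightarrow> bool"
  where "dykstra A B z a b p q \<longleftrightarrow>
     b 0 = z \<and> p 0 = 0 \<and> q 0 = 0 \<and>
     (\<forall>n\<ge>1.
        a n = closest_point A (b (n - 1) + p (n - 1)) \<and>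
        p n = b (n - 1) + p (n - 1) - a n \<and>
        b n = closest_point B (a n + q (n - 1)) \<and>
        q n = a n + q (n - 1) - b n)"

definition alternating_projections ::
    "'a::euclidean_space set \<Rightarrow> 'a set \<Rightarrow> 'a \<Rightarrow> (nat \<Rightarrow> 'a) \<Rightarrow> bool"
  where "alternating_projections A B c0 c \<longleftrightarrow>
     c 0 = c0 \<and>
     (\<forall>k\<ge>1. c (2 * k - 1) = closest_point A (c (2 * k - 2)) \<and>
            c (2 * k) = closest_point B (c (2 * k - 1)))"

definition unit_square :: "(real^2) set"
  where "unit_square = {x. x $ 1 \<in> {-1..1} \<and> x $ 2 \<in> {-1..1}}"

(* The hypothesis v \<in> (A - A)\<^sup>\<bottom> uses the Minkowski difference, written out as a
   comprehension because A - A denotes the set-theoretic difference here. *)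
definition line_square :: "(real^2) set \<Rightarrow> real^2 \<Rightarrow> real^2 \<Rightarrow> bool"
  where "line_square A u v \<longleftrightarrow>
     A = {u + w | w. w \<in> {v}\<^sup>\<bottom>} \<and>
     u \<in> A \<inter> unit_square \<and> u $ 1 > -1 \<and> u $ 2 = 1 \<and>
     v \<in> {x - y | x y. x \<in> A \<and> y \<in> A}\<^sup>\<bottom> \<and>
     norm v = 1 \<and> v $ 1 > 0 \<and> v $ 2 > 0"

end

theory Submission
  imports Defs
begin

text \<open>
  The increments \<open>p\<^sub>n\<close> are multiples of \<open>v\<close> and therefore invisible to the projection onto \<open>A\<close>, so
  \<open>a\<^sub>n = P\<^sub>A b\<^sub>n\<^sub>-\<^sub>1\<close> throughout. As long as \<open>b\<close> sits at the corner \<open>(-1, 1)\<close>, each cycle adds the fixed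
  vector \<open>(u(1) + 1) v(1) v\<close> to \<open>q\<close>, whose entries are positive; \<open>b\<close> leaves the corner exactly when
  the first entry of \<open>q\<close>, initially \<open>a\<^sub>1(1) + 1 \<le> 0\<close>, would become positive. From then on \<open>b\<close> moves
  along the top edge strictly to the left of \<open>u\<close>, and \<open>q\<close> is a nonnegative multiple of the outer
  normal \<open>(0, 1)\<close> of that edge, so adding it before projecting onto \<open>B\<close> changes nothing.
\<close>

text \<open>For every \<open>w\<close> in the hyperplane, \<open>x - w\<close> has the same
  component along \<open>v\<close>; by Cauchy-Schwarz this bounds the distance from below, and the
  stated point attains the bound.\<close>

lemma closest_point_hyperplane:
  fixes u v x :: "'a::euclidean_space"
  assumes "norm v = 1"
  shows "closest_point {u + w |w. w \<in> {v}\<^sup>\<bottom>} x = x - ((x - u) \<bullet> v) *\<^sub>R v"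
proof -
  have A: "{u + w |w. w \<in> {v}\<^sup>\<bottom>} = {y. v \<bullet> y = v \<bullet> u}"
  proof (rule set_eqI)
    fix y
    have "(\<exists>w. y = u + w \<and> v \<bullet> w = 0) \<longleftrightarrow> v \<bullet> (y - u) = 0"
      by (metis add_diff_cancel_left' diff_add_cancel)
    then show "y \<in> {u + w |w. w \<in> {v}\<^sup>\<bottom>} \<longleftrightarrow> y \<in> {y. v \<bullet> y = v \<bullet> u}"
      by (simp add: orthogonal_comp_def orthogonal_def inner_diff_right)
  qed
  have vv: "v \<bullet> v = 1" using assms by (simp add: dot_square_norm)
  define y where "y = x - ((x - u) \<bullet> v) *\<^sub>R v"
  have "y = closest_point {y. v \<bullet> y = v \<bullet> u} x"
  proof (rule closest_point_unique[OF convex_hyperplane closed_hyperplane])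
    show "y \<in> {y. v \<bullet> y = v \<bullet> u}"
      by (simp add: y_def inner_diff vv inner_commute)
    show "\<forall>w\<in>{y. v \<bullet> y = v \<bullet> u}. dist x y \<le> dist x w"
    proof
      fix w assume "w \<in> {y. v \<bullet> y = v \<bullet> u}"
      then have "(x - u) \<bullet> v = (x - w) \<bullet> v"
        by (simp add: inner_diff inner_commute)
      moreover have "\<bar>(x - w) \<bullet> v\<bar> \<le> norm (x - w) * norm v"
        by (rule Cauchy_Schwarz_ineq2)
      ultimately show "dist x y \<le> dist x w"
        using assms by (simp add: y_def dist_norm)
    qed
  qed
  then show ?thesis by (simp add: A y_def)
qed

lemma unit_square_eq_cbox: "unit_square = cbox (vector [-1, -1]) (vector [1, 1])"
  by (auto simp: unit_square_def mem_box_cart forall_2)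

text \<open>Clipping minimises the distance in each coordinate separately, hence also the Euclidean
  distance.\<close>

lemma closest_point_unit_square:
  "closest_point unit_square x = vector [max (-1) (min 1 (x $ 1)), max (-1) (min 1 (x $ 2))]"
proof -
  let ?y = "vector [max (-1) (min 1 (x $ 1)), max (-1) (min 1 (x $ 2))] :: real^2"
  have "?y = closest_point unit_square x"
  proof (rule closest_point_unique)
    show "convex unit_square" "closed unit_square"
      unfolding unit_square_eq_cbox by (rule convex_box closed_cbox)+
    show "?y \<in> unit_square" by (auto simp: unit_square_def)
    show "\<forall>w\<in>unit_square. dist x ?y \<le> dist x w"
    proof
      fix w :: "real^2" assume "w \<in> unit_square"
      then have "dist (x $ i) (?y $ i) \<le> dist (x $ i) (w $ i)" for i
        using exhaust_2[of i] by (auto simp: unit_square_def dist_real_def)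
      then show "dist x ?y \<le> dist x w"
        unfolding dist_vec_def by (intro L2_set_mono) auto
    qed
  qed
  then show ?thesis by simp
qed

lemma dykstra_hyperplane:
  assumes "dykstra A B z a b p q" and "A = {u + w |w. w \<in> {v}\<^sup>\<bottom>}" and v: "norm v = 1"
    and "k \<ge> 1"
  shows "a k = closest_point A (b (k - 1))"
proof -
  note P = closest_point_hyperplane[OF v, of u, folded assms(2)]
  have step: "a n = closest_point A (b (n - 1) + p (n - 1))"
    "p n = b (n - 1) + p (n - 1) - a n" if "n \<ge> 1" for n
    using assms(1) that by (auto simp: dykstra_def)
  \<comment> \<open>A case split suffices: for \<open>n \<ge> 1\<close> the vector
    \<open>p n\<close> is the residual of a projection onto \<open>A\<close>, whatever
    \<open>p (n - 1)\<close> was.\<close>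
  have "\<exists>t. p n = t *\<^sub>R v" for n
  proof (cases n)
    case 0
    then have "p n = 0 *\<^sub>R v" using assms(1) by (simp add: dykstra_def)
    then show ?thesis by blast
  next
    case (Suc m)
    then show ?thesis using step[of n] by (auto simp: P)
  qed
  then obtain t where t: "p (k - 1) = t *\<^sub>R v" by blast
  have "v \<bullet> v = 1" using v by (simp add: dot_square_norm)
  then show ?thesis
    unfolding step(1)[OF \<open>k \<ge> 1\<close>] t P by (simp add: algebra_simps)
qed

theorem theorem4p5:
  fixes A B :: "(real^2) set" and u v z :: "real^2"
    and a b p q :: "nat \<Rightarrow> real^2" and n :: nat
  assumes "line_square A u v"
    and "B = unit_square"
    and "dykstra A B z a b p q"
    and "a 1 $ 1 \<le> -1" and "1 < a 1 $ 2"
    and "n = 1 + nat \<lfloor>(-1 - a 1 $ 1) / ((u $ 1 + 1) * (v $ 1)\<^sup>2)\<rfloor>"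
  shows "(\<forall>k\<in>{1..n}. b k = vector [-1, 1]) \<and>
    b (n + 1) \<noteq> vector [-1, 1] \<and>
    (\<forall>k\<ge>1. a (n + 1 + k) = closest_point A (b (n + k)) \<and>
            b (n + 1 + k) = closest_point B (a (n + 1 + k))) \<and>
    (\<exists>c. alternating_projections A B (b (n + 1)) c \<and>
         (\<forall>k\<ge>1. a (n + 1 + k) = c (2 * k - 1) \<and> b (n + 1 + k) = c (2 * k)))"
proof -
  have A: "A = {u + w |w. w \<in> {v}\<^sup>\<bottom>}" and u: "-1 < u $ 1" "u $ 1 \<le> 1" "u $ 2 = 1"
    and v: "norm v = 1" "0 < v $ 1" "0 < v $ 2"
    using assms(1) by (auto simp: line_square_def unit_square_def)
  have "v \<bullet> v = 1" using v by (simp add: dot_square_norm)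
  then have "v $ 1 * v $ 1 + v $ 2 * v $ 2 = 1" by (simp add: inner_vec_def sum_2)
  moreover have "0 < v $ 2 * v $ 2" using v by simp
  ultimately have v1: "(v $ 1)\<^sup>2 < 1" by (simp add: power2_eq_square)

  have aP: "a (Suc k) = closest_point A (b k)" for k
    using dykstra_hyperplane[OF assms(3) A v(1), of "Suc k"] by simp
  \<comment> \<open>At height 1 the vector \<open>b k - u\<close> is horizontal, so only its first
    entry enters the projection formula.\<close>
  have a1: "a (Suc k) $ 1 = b k $ 1 + (u $ 1 - b k $ 1) * (v $ 1)\<^sup>2"
    and a2: "a (Suc k) $ 2 = 1 + (u $ 1 - b k $ 1) * (v $ 1) * (v $ 2)"
    if "b k $ 2 = 1" for k
    using that u unfolding aP A closest_point_hyperplane[OF v(1)]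
    by (simp_all add: inner_vec_def sum_2 power2_eq_square algebra_simps)
  have bB: "b (Suc k) = closest_point B (a (Suc k) + q k)"
    and qS: "q (Suc k) = a (Suc k) + q k - b (Suc k)" for k
    using assms(3) unfolding dykstra_def by (auto dest!: spec[of _ "Suc k"])
  have b1: "b (Suc k) $ 1 = max (-1) (min 1 (a (Suc k) $ 1 + q k $ 1))"
    and b2: "b (Suc k) $ 2 = max (-1) (min 1 (a (Suc k) $ 2 + q k $ 2))" for k
    unfolding bB assms(2) closest_point_unit_square by simp_all
  have q_nth: "q (Suc k) $ i = a (Suc k) $ i + q k $ i - b (Suc k) $ i" for k i
    by (simp add: qS)
  have q0: "q 0 = 0" using assms(3) by (simp add: dykstra_def)

  \<comment> \<open>Projecting the corner onto \<open>A\<close> shifts its first coordinate by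
    \<open>\<delta>\<close>; this is the growth of the first entry of \<open>q\<close> per stalled
    cycle.\<close>
  define \<delta> where "\<delta> = (u $ 1 + 1) * (v $ 1)\<^sup>2"
  have \<delta>: "0 < \<delta>" using u v by (simp add: \<delta>_def)
  have "(u $ 1 + 1) * (v $ 1)\<^sup>2 < (u $ 1 + 1) * 1"
    using u v1 by (intro mult_strict_left_mono) auto
  then have \<delta>u: "\<delta> < u $ 1 + 1" by (simp add: \<delta>_def)
  define r where "r = (-1 - a 1 $ 1) / \<delta>"
  have r0: "0 \<le> r" using assms(4) \<delta> by (simp add: r_def)
  have r\<delta>: "r * \<delta> = -1 - a 1 $ 1" using \<delta> by (simp add: r_def)
  define m where "m = nat \<lfloor>r\<rfloor>"
  have n: "n = Suc m" using assms(6) by (simp add: m_def r_def \<delta>_def)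
  have "real m \<le> r" "r < real m + 1" using r0 by (auto simp: m_def)
  then have m: "real m * \<delta> \<le> r * \<delta>" "r * \<delta> < (real m + 1) * \<delta>" using \<delta> by simp_all

  \<comment> \<open>The first cycle starts from \<open>q 0 = 0\<close> and leaves \<open>a 1\<close>
    minus the corner in \<open>q 1\<close>, hence the offset \<open>a 1 $ 1 + 1\<close> and the
    shifted index. The bound \<open>k \<le> m\<close> keeps the first entry of \<open>q\<close> at
    most 0.\<close>
  have stall: "b (Suc k) $ 1 = -1 \<and> b (Suc k) $ 2 = 1 \<and>
      q (Suc k) $ 1 = a 1 $ 1 + 1 + real k * \<delta> \<and> 0 < q (Suc k) $ 2" if "k \<le> m" for k
    using that
  proof (induction k)
    case 0
    then show ?case using assms(4,5) b1[of 0] b2[of 0] q_nth[of 0] by (simp add: q0)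
  next
    case (Suc k)
    then have IH: "b (Suc k) $ 1 = -1" "b (Suc k) $ 2 = 1"
      "q (Suc k) $ 1 = a 1 $ 1 + 1 + real k * \<delta>" "0 < q (Suc k) $ 2" by auto
    have "real (Suc k) * \<delta> \<le> real m * \<delta>" using Suc.prems \<delta> by (intro mult_right_mono) auto
    then have "real (Suc k) * \<delta> \<le> -1 - a 1 $ 1" using m r\<delta> by simp
    moreover have "a (Suc (Suc k)) $ 1 = -1 + \<delta>"
      using a1[OF IH(2)] IH by (simp add: \<delta>_def)
    moreover have "1 < a (Suc (Suc k)) $ 2"
      using a2[OF IH(2)] IH u v by simp
    ultimately show ?case
      using b1[of "Suc k"] b2[of "Suc k"] q_nth[of "Suc k"] IH by (simp add: distrib_right)
  qed
  have corner: "x = vector [-1, 1] \<longleftrightarrow> x $ 1 = -1 \<and> x $ 2 = 1" for x :: "real^2"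
    by (simp add: vec_eq_iff forall_2)
  have stalls: "\<forall>k\<in>{1..n}. b k = vector [-1, 1]"
  proof
    fix k assume "k \<in> {1..n}"
    then obtain j where "k = Suc j" "j \<le> m" using n by (cases k) auto
    then show "b k = vector [-1, 1]" using stall[of j] corner by simp
  qed

  \<comment> \<open>At \<open>k = 0\<close> the first coordinate is
    \<open>a 1 $ 1 + (m + 1) * \<delta>\<close>: above -1 by the choice of \<open>m\<close>, and at
    most \<open>-1 + \<delta>\<close>, which is below \<open>u $ 1\<close>. It is not clipped, so
    the first entry of \<open>q\<close> becomes 0.\<close>
  have free: "-1 < b (Suc n + k) $ 1 \<and> b (Suc n + k) $ 1 < u $ 1 \<and> b (Suc n + k) $ 2 = 1 \<and>
      q (Suc n + k) $ 1 = 0 \<and> 0 < q (Suc n + k) $ 2" for k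
  proof (induction k)
    case 0
    have S: "b n $ 1 = -1" "b n $ 2 = 1" "q n $ 1 = a 1 $ 1 + 1 + real m * \<delta>" "0 < q n $ 2"
      using stall[of m] n by auto
    have "a (Suc n) $ 1 = -1 + \<delta>" using a1[OF S(2)] S by (simp add: \<delta>_def)
    moreover have "1 < a (Suc n) $ 2" using a2[OF S(2)] S u v by simp
    ultimately show ?case
      using b1[of n] b2[of n] q_nth[of n] S m r\<delta> \<delta>u u by (simp add: distrib_right)
  next
    case (Suc k)
    then have IH: "-1 < b (Suc n + k) $ 1" "b (Suc n + k) $ 1 < u $ 1" "b (Suc n + k) $ 2 = 1"
      "q (Suc n + k) $ 1 = 0" "0 < q (Suc n + k) $ 2" by auto
    let ?d = "u $ 1 - b (Suc n + k) $ 1"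
    have "0 < ?d * (v $ 1)\<^sup>2" using IH v by simp
    \<comment> \<open>Since \<open>(v $ 1)\<^sup>2 < 1\<close>, the step to the right stops short of
      \<open>u\<close>, so the invariant survives.\<close>
    moreover have "?d * (v $ 1)\<^sup>2 < ?d * 1"
      using IH v1 by (intro mult_strict_left_mono) auto
    moreover have "0 < ?d * v $ 1 * v $ 2" using IH v by simp
    ultimately show ?case
      using a1[OF IH(3)] a2[OF IH(3)] b1[of "Suc n + k"] b2[of "Suc n + k"] q_nth[of "Suc n + k"] IH u
      by simp
  qed
  have leaves: "b (n + 1) \<noteq> vector [-1, 1]" using free[of 0] corner by simp

  have bP: "b (Suc (Suc n + k)) = closest_point B (a (Suc (Suc n + k)))" for k
  proof -
    have F: "b (Suc n + k) $ 1 < u $ 1" "b (Suc n + k) $ 2 = 1"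
      "q (Suc n + k) $ 1 = 0" "0 < q (Suc n + k) $ 2" using free[of k] by auto
    have "0 < (u $ 1 - b (Suc n + k) $ 1) * v $ 1 * v $ 2" using F v by simp
    then have "1 < a (Suc (Suc n + k)) $ 2" using a2[OF F(2)] by simp
    \<comment> \<open>With and without \<open>q\<close>, the second coordinate exceeds 1 and is
      clipped to 1, while the first is the same.\<close>
    then show ?thesis
      unfolding bB assms(2) closest_point_unit_square using F by simp
  qed
  have MAP: "a (n + 1 + k) = closest_point A (b (n + k)) \<and>
      b (n + 1 + k) = closest_point B (a (n + 1 + k))" if "k \<ge> 1" for k
  proof -
    obtain j where "k = Suc j" using \<open>k \<ge> 1\<close> by (cases k) auto
    then show ?thesis using aP[of "n + k"] bP[of j] by simp
  qed

  \<comment> \<open>Interleaves the two sequences from \<open>b (n + 1)\<close> on;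
    \<open>Suc j div 2\<close> rounds up, so \<open>c (2 * k - 1)\<close> is
    \<open>a (n + 1 + k)\<close>.\<close>
  define c where "c j = (if even j then b (n + 1 + j div 2) else a (n + 1 + Suc j div 2))" for j
  have c: "c (2 * k) = b (n + 1 + k)" "c (2 * k - 1) = a (n + 1 + k)"
    "c (2 * k - 2) = b (n + k)" if "k \<ge> 1" for k
    using that by (cases k; simp add: c_def)+
  have "alternating_projections A B (b (n + 1)) c"
    unfolding alternating_projections_def using MAP c by (auto simp: c_def[of 0])
  with stalls leaves MAP c show ?thesis by auto
qed

end
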